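(* For every BPPS instance, $$\frac{\zeta(\mathrm{LP}^{\dagger}_{\mathrm N})}{OPT}>\frac12.$$
   Context: Bin Packing Problem with Setups (BPPS). An instance consists of: a bin capacity $d\in\mathbb Z_{\ge1}$; items $\mathcal I=\{1,\dots,n\}$ with weights $w_i\in\mathbb Z_{\ge1}$; classes $\mathcal C=\{1,\dots,m\}$ and a partition $\{\mathcal I_1,\dots,\mathcal I_m\}$ of $\mathcal I$ into (nonempty) classes; for each class $c$ a setup weight $s_c\in\mathbb Z_{\ge0}$ and a setup cost $f_c\in\mathbb Z_{\ge0}$; a bin cost $r\in\mathbb Z_{\ge1}$. It is assumed that $w_i+s_c\le d$ for all $c\in\mathcal C$, $i\in\mathcal I_c$, and that the items cannot all be packed in a single bin, i.e. $\sum_{i\in\mathcal I}w_i+\sum_{c\in\mathcal C}s_c>d$. For $S\subseteq\mathcal I$ let $\mathcal C(S)=\{c\in\mathcal C: S\cap\mathcal I_c\neq\emptyset\}$. A packing pattern is a subset $S\subseteq\mathcal I$ with $\sum_{i\in S}w_i+\sum_{c\in\mathcal C(S)}s_c\le d$. A feasible solution is a partition $\mathcal S$ of $\mathcal I$ into (nonempty) packing patterns (used bins); its cost is $r|\mathcal S|+\sum_{S\in\mathcal S}\sum_{c\in\mathcal C(S)}f_c$. $OPT$ denotes the minimum cost of a feasible solution. For $c\in\mathcal C$ let $\gamma_c=\left\lceil\frac{\sum_{i\in\mathcal I_c}w_i}{d-s_c}\right\rceil$. Let $k\in\mathbb Z_{\ge1}$ be an upper bound on the number of bins used in any optimal BPPS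 solution and $\mathcal B=\{1,\dots,k\}$. The linear program $\mathrm{LP}^{\dagger}_{\mathrm N}$ is: minimize $\sum_{b\in\mathcal B}\big(r z_b+\sum_{c\in\mathcal C}f_c y_{cb}\big)$ subject to - $\sum_{b\in\mathcal B}x_{ib}=1$ for all $i\in\mathcal I$; - $\sum_{i\in\mathcal I}w_ix_{ib}+\sum_{c\in\mathcal C}s_cy_{cb}\le d\,z_b$ for all $b\in\mathcal B$; - $x_{ib}\le y_{cb}$ for all $c\in\mathcal C$, $i\in\mathcal I_c$, $b\in\mathcal B$; - $\sum_{b\in\mathcal B}y_{cb}\ge\gamma_c$ for all $c\in\mathcal C$ (Minimum Classes Inequalities); - $0\le x_{ib}\le1$, $0\le y_{cb}\le1$, $0\le z_b\le1$ for all $i\in\mathcal I,c\in\mathcal C,b\in\mathcal B$. $\zeta(\mathrm{LP}^{\dagger}_{\mathrm N})$ denotes its optimal objective function value. *)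

theory Defs
  imports Complex_Main "HOL-Library.Disjoint_Sets"
begin

section \<open>Bin packing with setups\<close>

text \<open>Items are \<open>1, \<dots>, num_items\<close> and classes are \<open>1, \<dots>, num_classes\<close>; values of the
  functions below outside these ranges play no role.\<close>

record bpps =
  capacity :: nat
  num_items :: nat
  num_classes :: nat
  weight :: "nat \<Rightarrow> nat"
  members :: "nat \<Rightarrow> nat set"
  setup_weight :: "nat \<Rightarrow> nat"
  setup_cost :: "nat \<Rightarrow> nat"
  bin_cost :: nat

definition items :: "bpps \<Rightarrow> nat set" where
  "items P = {1..num_items P}"

definition classes :: "bpps \<Rightarrow> nat set" where
  "classes P = {1..num_classes P}"

definition bpps_instance :: "bpps \<Rightarrow> bool" where
  "bpps_instance P \<longleftrightarrow>
     capacity P \<ge> 1 \<and>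
     bin_cost P \<ge> 1 \<and>
     (\<forall>i\<in>items P. weight P i \<ge> 1) \<and>
     (\<Union>c\<in>classes P. members P c) = items P \<and>
     disjoint_family_on (members P) (classes P) \<and>
     (\<forall>c\<in>classes P. members P c \<noteq> {}) \<and>
     (\<forall>c\<in>classes P. \<forall>i\<in>members P c. weight P i + setup_weight P c \<le> capacity P) \<and>
     (\<Sum>i\<in>items P. weight P i) + (\<Sum>c\<in>classes P. setup_weight P c) > capacity P"

definition classes_of :: "bpps \<Rightarrow> nat set \<Rightarrow> nat set" where
  "classes_of P S = {c \<in> classes P. S \<inter> members P c \<noteq> {}}"

definition packing_pattern :: "bpps \<Rightarrow> nat set \<Rightarrow> bool" where
  "packing_pattern P S \<longleftrightarrow>
     S \<subseteq> items P \<and>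
     (\<Sum>i\<in>S. weight P i) + (\<Sum>c\<in>classes_of P S. setup_weight P c) \<le> capacity P"

definition feasible_solution :: "bpps \<Rightarrow> nat set set \<Rightarrow> bool" where
  "feasible_solution P \<S> \<longleftrightarrow>
     partition_on (items P) \<S> \<and> (\<forall>S\<in>\<S>. packing_pattern P S)"

definition solution_cost :: "bpps \<Rightarrow> nat set set \<Rightarrow> nat" where
  "solution_cost P \<S> =
     bin_cost P * card \<S> + (\<Sum>S\<in>\<S>. \<Sum>c\<in>classes_of P S. setup_cost P c)"

text \<open>There are only finitely many partitions of the item set, and for an instance the
  partition into singletons is feasible, so this minimum is over a finite nonempty set.\<close>

definition opt :: "bpps \<Rightarrow> nat" where
  "opt P = Min (solution_cost P ` {\<S>. feasible_solution P \<S>})"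

definition optimal_solution :: "bpps \<Rightarrow> nat set set \<Rightarrow> bool" where
  "optimal_solution P \<S> \<longleftrightarrow> feasible_solution P \<S> \<and> solution_cost P \<S> = opt P"

section \<open>The linear relaxation with minimum classes inequalities\<close>

definition min_class_bins :: "bpps \<Rightarrow> nat \<Rightarrow> int" where
  "min_class_bins P c =
     \<lceil>(\<Sum>i\<in>members P c. real (weight P i)) / (real (capacity P) - real (setup_weight P c))\<rceil>"

definition lp_feasible ::
  "bpps \<Rightarrow> nat \<Rightarrow> (nat \<Rightarrow> nat \<Rightarrow> real) \<Rightarrow> (nat \<Rightarrow> nat \<Rightarrow> real) \<Rightarrow> (nat \<Rightarrow> real) \<Rightarrow> bool" where
  "lp_feasible P k x y z \<longleftrightarrow>
     (\<forall>i\<in>items P. (\<Sum>b\<in>{1..k}. x i b) = 1) \<and>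
     (\<forall>b\<in>{1..k}. (\<Sum>i\<in>items P. real (weight P i) * x i b)
        + (\<Sum>c\<in>classes P. real (setup_weight P c) * y c b) \<le> real (capacity P) * z b) \<and>
     (\<forall>c\<in>classes P. \<forall>i\<in>members P c. \<forall>b\<in>{1..k}. x i b \<le> y c b) \<and>
     (\<forall>c\<in>classes P. (\<Sum>b\<in>{1..k}. y c b) \<ge> of_int (min_class_bins P c)) \<and>
     (\<forall>i\<in>items P. \<forall>b\<in>{1..k}. 0 \<le> x i b \<and> x i b \<le> 1) \<and>
     (\<forall>c\<in>classes P. \<forall>b\<in>{1..k}. 0 \<le> y c b \<and> y c b \<le> 1) \<and>
     (\<forall>b\<in>{1..k}. 0 \<le> z b \<and> z b \<le> 1)"

definition lp_objective ::
  "bpps \<Rightarrow> nat \<Rightarrow> (nat \<Rightarrow> nat \<Rightarrow> real) \<Rightarrow> (nat \<Rightarrow> real) \<Rightarrow> real" where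
  "lp_objective P k y z =
     (\<Sum>b\<in>{1..k}. real (bin_cost P) * z b + (\<Sum>c\<in>classes P. real (setup_cost P c) * y c b))"

text \<open>The objective is nonnegative on the feasible region. If \<open>k\<close> bounds the number of bins of an
  optimal solution, that solution satisfies all constraints, so the region is also nonempty; being
  compact (up to irrelevant coordinates), the infimum is then a minimum.\<close>

definition lp_value :: "bpps \<Rightarrow> nat \<Rightarrow> real" where
  "lp_value P k = Inf {lp_objective P k y z | x y z. lp_feasible P k x y z}"

end

theory Submission
  imports Defs
begin

text \<open>Summing the capacity constraints of the linear program gives
  \<open>\<zeta> \<ge> r L / d + (\<Sum>c. f\<^sub>c \<gamma>\<^sub>c)\<close>, where \<open>L = (\<Sum>c. W\<^sub>c + s\<^sub>c \<gamma>\<^sub>c)\<close> and \<open>W\<^sub>c\<close> is the total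
  weight of class \<open>c\<close>. So it suffices to find a packing with fewer than \<open>2 L / d\<close> bins in which each
  class \<open>c\<close> meets at most \<open>2 \<gamma>\<^sub>c\<close> bins. Pack each class separately into bins of capacity \<open>d - s\<^sub>c\<close>, no
  two of which can be merged. If this gives \<open>n \<ge> 2\<close> bins, they are more than half full on average,
  so \<open>\<gamma>\<^sub>c > n / 2\<close> and the class contributes more than \<open>n d / 2\<close> to \<open>L\<close>. The remaining classes are
  packed as single items of weight \<open>W\<^sub>c + s\<^sub>c\<close>, again without mergeable bins; two or more such bins
  are more than half full on average. A single such bin is either merged into a bin of some class
  with \<open>n \<ge> 2\<close>, or it is counted together with the bins of that class, where \<open>2 \<gamma>\<^sub>c \<ge> n + 1\<close>
  leaves room for it.\<close>

section \<open>Packings without mergeable bins\<close>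

text \<open>The minimiser \<open>m\<close> and one further index together exceed \<open>D\<close>.
  Every remaining \<open>j\<close> has \<open>2 * u j\<close> at least \<open>u m + u j\<close>,
  hence above \<open>D\<close>. Comparing with the minimiser avoids any parity argument.\<close>

lemma pairwise_sum_bound:
  fixes u :: "'a \<Rightarrow> nat"
  assumes "finite J" "2 \<le> card J"
    and pair: "\<And>j j'. j \<in> J \<Longrightarrow> j' \<in> J \<Longrightarrow> j \<noteq> j' \<Longrightarrow> D < u j + u j'"
  shows "card J * D < 2 * sum u J"
proof -
  have "J \<noteq> {}" using assms(2) by auto
  then obtain m where m: "m \<in> J" "\<And>j. j \<in> J \<Longrightarrow> u m \<le> u j"
    using ex_min_if_finite[of "u ` J"] assms(1)
    by (metis (mono_tags, lifting) arg_min_if_finite(1) arg_min_least)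
  have "J - {m} \<noteq> {}"
    using assms(1,2) m(1) by (metis One_nat_def Suc_1 card.empty card_Diff_singleton diff_is_0_eq not_less_eq_eq)
  then obtain j1 where j1: "j1 \<in> J" "j1 \<noteq> m" by auto
  define R where "R = J - {m, j1}"
  have J: "J = insert m (insert j1 R)" "m \<notin> insert j1 R" "j1 \<notin> R" "finite R"
    using m j1 assms(1) by (auto simp: R_def)
  have "D \<le> 2 * u j" if "j \<in> R" for j
    using pair[of m j] m that unfolding R_def by fastforce
  then have "card R * D \<le> (\<Sum>j\<in>R. 2 * u j)"
    using sum_bounded_below[of R D "\<lambda>j. 2 * u j"] by simp
  moreover have "D < u m + u j1" using pair m j1 by auto
  ultimately show ?thesis
    using J(2-4) unfolding J(1) by (simp add: sum_distrib_left[symmetric])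
qed

text \<open>A packing is encoded by the bin label of each item, so that merging bins is a
  relabelling. The second clause is restricted to labels in use, since other labels have load
  0.\<close>

definition unmergeable_packing :: "'a set \<Rightarrow> ('a \<Rightarrow> nat) \<Rightarrow> nat \<Rightarrow> ('a \<Rightarrow> 'b) \<Rightarrow> bool" where
  "unmergeable_packing A w D a \<longleftrightarrow>
     (\<forall>j. sum w {i \<in> A. a i = j} \<le> D) \<and>
     (\<forall>j\<in>a ` A. \<forall>j'\<in>a ` A. j \<noteq> j' \<longrightarrow>
       D < sum w {i \<in> A. a i = j} + sum w {i \<in> A. a i = j'})"

text \<open>An admissible assignment with the fewest labels in use works: merging two bins that fit
  together would free a label. One bin per item is admissible, which is why items serve as
  labels.\<close>

lemma ex_unmergeable_packing:
  fixes w :: "'a \<Rightarrow> nat"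
  assumes "finite A" "\<And>i. i \<in> A \<Longrightarrow> w i \<le> D"
  shows "\<exists>a :: 'a \<Rightarrow> 'a. unmergeable_packing A w D a"
proof -
  let ?ok = "\<lambda>a :: 'a \<Rightarrow> 'a. \<forall>j. sum w {i \<in> A. a i = j} \<le> D"
  have "?ok id"
  proof
    fix j
    have "{i \<in> A. id i = j} = (if j \<in> A then {j} else {})" by auto
    then show "sum w {i \<in> A. id i = j} \<le> D" using assms by simp
  qed
  then obtain a where a: "?ok a" "\<forall>b. ?ok b \<longrightarrow> card (a ` A) \<le> card (b ` A)"
    using ex_has_least_nat[of ?ok id "\<lambda>a. card (a ` A)"] by fast
  have "unmergeable_packing A w D a"
    unfolding unmergeable_packing_def
  proof (intro conjI ballI impI)
    fix j j' assume j: "j \<in> a ` A" "j' \<in> a ` A" "j \<noteq> j'"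
    show "D < sum w {i \<in> A. a i = j} + sum w {i \<in> A. a i = j'}"
    proof (rule ccontr)
      assume *: "\<not> ?thesis"
      \<comment> \<open>Bin \<open>j'\<close> is poured into bin \<open>j\<close>, so the label
        \<open>j'\<close> falls out of use.\<close>
      define b where "b i = (if a i = j' then j else a i)" for i
      have "?ok b"
      proof
        fix t
        consider "t = j" | "t = j'" | "t \<noteq> j" "t \<noteq> j'" by blast
        then show "sum w {i \<in> A. b i = t} \<le> D"
        proof cases
          case 1
          have "{i \<in> A. b i = t} = {i \<in> A. a i = j} \<union> {i \<in> A. a i = j'}"
            using 1 by (auto simp: b_def)
          moreover have "sum w ({i \<in> A. a i = j} \<union> {i \<in> A. a i = j'}) =
              sum w {i \<in> A. a i = j} + sum w {i \<in> A. a i = j'}"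
            using assms(1) j(3) by (intro sum.union_disjoint) auto
          ultimately show ?thesis using * by simp
        next
          case 2
          then have "{i \<in> A. b i = t} = {}" using j(3) by (auto simp: b_def)
          then show ?thesis by (metis sum.empty zero_le)
        next
          case 3
          then have "{i \<in> A. b i = t} = {i \<in> A. a i = t}" by (auto simp: b_def)
          then show ?thesis using a(1) by simp
        qed
      qed
      moreover have "b ` A \<subset> a ` A"
      proof
        show "b ` A \<subseteq> a ` A" using j by (auto simp: b_def)
        have "j' \<notin> b ` A" using j(3) by (auto simp: b_def)
        then show "b ` A \<noteq> a ` A" using j(2) by blast
      qed
      then have "card (b ` A) < card (a ` A)" using assms(1) by (simp add: psubset_card_mono)
      ultimately show False using a(2) by (meson leD)
    qed
  qed (use a(1) in blast)
  then show ?thesis by blast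
qed

lemma sum_over_fibers:
  fixes w :: "'a \<Rightarrow> nat"
  assumes "finite A"
  shows "(\<Sum>j\<in>a ` A. sum w {i \<in> A. a i = j}) = sum w A"
  using sum.image_gen[OF assms, of w a] by simp

section \<open>Elementary facts about an instance\<close>

context
  fixes P :: bpps
  assumes inst: "bpps_instance P"
begin

lemma finite_items: "finite (items P)" and finite_classes: "finite (classes P)"
  by (simp_all add: items_def classes_def)

lemma members_subset: "c \<in> classes P \<Longrightarrow> members P c \<subseteq> items P"
  using inst unfolding bpps_instance_def by auto

lemma finite_members: "c \<in> classes P \<Longrightarrow> finite (members P c)"
  using members_subset finite_items finite_subset by blast

lemma items_Union: "items P = (\<Union>c\<in>classes P. members P c)"
  using inst unfolding bpps_instance_def by simp

lemma members_unique:
  "c \<in> classes P \<Longrightarrow> c' \<in> classes P \<Longrightarrow> i \<in> members P c \<Longrightarrow> i \<in> members P c' \<Longrightarrow> c = c'"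
  using inst unfolding bpps_instance_def disjoint_family_on_def by blast

lemma sum_by_class:
  assumes "S \<subseteq> items P"
  shows "sum g S = (\<Sum>c\<in>classes P. sum g (S \<inter> members P c))"
proof -
  have S: "S = (\<Union>c\<in>classes P. S \<inter> members P c)" using assms items_Union by blast
  have "sum g (\<Union>c\<in>classes P. S \<inter> members P c) = (\<Sum>c\<in>classes P. sum g (S \<inter> members P c))"
    using finite_classes finite_members members_unique by (intro sum.UNION_disjoint) auto
  then show ?thesis using S by simp
qed

text \<open>Some item of the class has positive weight and fits beside the setup. Strictness makes
  the denominator in \<open>min_class_bins\<close> positive.\<close>

lemma setup_less_capacity:
  assumes "c \<in> classes P" shows "setup_weight P c < capacity P"
proof -
  obtain i where i: "i \<in> members P c" using inst assms unfolding bpps_instance_def by blast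
  then have "weight P i \<ge> 1" "weight P i + setup_weight P c \<le> capacity P"
    using inst assms members_subset unfolding bpps_instance_def by blast+
  then show ?thesis by simp
qed

lemma capacity_pos: "capacity P > 0" and bin_cost_pos: "bin_cost P > 0"
  using inst by (auto simp: bpps_instance_def)

text \<open>Without classes there are no items, and a total weight of 0 cannot exceed the
  capacity.\<close>

lemma classes_nonempty: "classes P \<noteq> {}"
  using inst unfolding bpps_instance_def by auto

lemma items_nonempty: "items P \<noteq> {}"
  using inst classes_nonempty unfolding bpps_instance_def by blast

lemma class_weight_pos:
  assumes "c \<in> classes P" shows "0 < sum (weight P) (members P c)"
proof -
  obtain i where i: "i \<in> members P c" using inst assms unfolding bpps_instance_def by blast
  then have "weight P i \<ge> 1"
    using inst assms members_subset unfolding bpps_instance_def by blast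
  then show ?thesis using i finite_members[OF assms]
    by (intro sum_pos2[of _ i]) auto
qed

lemma class_weight_le:
  assumes "c \<in> classes P"
  shows "real (sum (weight P) (members P c)) \<le>
    of_int (min_class_bins P c) * (real (capacity P) - real (setup_weight P c))"
proof -
  have "real (capacity P) - real (setup_weight P c) > 0" using setup_less_capacity[OF assms] by simp
  then show ?thesis unfolding min_class_bins_def
    by (metis ceiling_correct of_nat_sum pos_divide_le_eq)
qed

lemma min_class_bins_pos:
  assumes "c \<in> classes P" shows "1 \<le> min_class_bins P c"
proof -
  have "0 < of_int (min_class_bins P c) * (real (capacity P) - real (setup_weight P c))"
    using class_weight_le[OF assms] class_weight_pos[OF assms] by linarith
  then have "0 < real_of_int (min_class_bins P c)"
    using setup_less_capacity[OF assms] by (simp add: zero_less_mult_iff)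
  then show ?thesis by linarith
qed

section \<open>Feasible solutions and their cost\<close>

lemma finite_solutions: "finite {\<S>. feasible_solution P \<S>}"
proof (rule finite_subset)
  show "{\<S>. feasible_solution P \<S>} \<subseteq> Pow (Pow (items P))"
    unfolding feasible_solution_def packing_pattern_def by auto
qed (simp add: finite_items)

lemma opt_le: "feasible_solution P \<S> \<Longrightarrow> opt P \<le> solution_cost P \<S>"
  unfolding opt_def using finite_solutions by (intro Min_le) auto

text \<open>The set \<open>T\<close> may contain classes that \<open>S\<close> misses: they only add
  setup weight, so a convenient superset of \<open>classes_of P S\<close> is enough to check the
  capacity.\<close>

lemma packing_patternI:
  assumes "S \<subseteq> items P" "classes_of P S \<subseteq> T" "T \<subseteq> classes P"
    and "(\<Sum>c\<in>T. sum (weight P) (S \<inter> members P c) + setup_weight P c) \<le> capacity P"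
  shows "packing_pattern P S"
proof -
  have finT: "finite T" using assms(3) finite_classes finite_subset by blast
  have "sum (weight P) S = (\<Sum>c\<in>classes P. sum (weight P) (S \<inter> members P c))"
    by (rule sum_by_class[OF assms(1)])
  also have "\<dots> = (\<Sum>c\<in>T. sum (weight P) (S \<inter> members P c))"
    using assms(2,3) finite_classes
    by (intro sum.mono_neutral_right) (auto simp: classes_of_def subset_iff)
  finally have "sum (weight P) S = \<dots>" .
  moreover have "sum (setup_weight P) (classes_of P S) \<le> sum (setup_weight P) T"
    using assms(2) finT by (intro sum_mono2) auto
  ultimately show ?thesis
    using assms(1,4) unfolding packing_pattern_def by (simp add: sum.distrib)
qed

text \<open>Exchanging the sums counts the bins met by each class, which can then be compared with
  \<open>min_class_bins\<close> class by class.\<close>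

lemma solution_cost_by_class:
  assumes "finite \<S>"
  shows "solution_cost P \<S> = bin_cost P * card \<S> +
    (\<Sum>c\<in>classes P. setup_cost P c * card {S \<in> \<S>. S \<inter> members P c \<noteq> {}})"
proof -
  have "(\<Sum>S\<in>\<S>. \<Sum>c\<in>classes_of P S. setup_cost P c) =
      (\<Sum>S\<in>\<S>. \<Sum>c\<in>classes P. if S \<inter> members P c \<noteq> {} then setup_cost P c else 0)"
    unfolding classes_of_def by (intro sum.cong[OF refl] sum.inter_filter finite_classes)
  also have "\<dots> = (\<Sum>c\<in>classes P. \<Sum>S\<in>\<S>. if S \<inter> members P c \<noteq> {} then setup_cost P c else 0)"
    by (rule sum.swap)
  also have "\<dots> = (\<Sum>c\<in>classes P. setup_cost P c * card {S \<in> \<S>. S \<inter> members P c \<noteq> {}})"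
    using assms by (intro sum.cong refl) (simp add: sum.inter_filter[symmetric])
  finally show ?thesis unfolding solution_cost_def by simp
qed

text \<open>The bins are the fibres of the labelling, and they partition the items. This lets
  packings be built from labels, without handling set partitions again.\<close>

lemma opt_le_assignment:
  fixes \<alpha> :: "nat \<Rightarrow> nat \<Rightarrow> 'l"
  assumes load: "\<And>l. (\<Sum>c | c \<in> classes P \<and> l \<in> \<alpha> c ` members P c.
      sum (weight P) {i \<in> members P c. \<alpha> c i = l} + setup_weight P c) \<le> capacity P"
  shows "opt P \<le> bin_cost P * card (\<Union>c\<in>classes P. \<alpha> c ` members P c) +
    (\<Sum>c\<in>classes P. setup_cost P c * card (\<alpha> c ` members P c))"
proof -
  define L where "L = (\<Union>c\<in>classes P. \<alpha> c ` members P c)"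
  define F where "F l = (\<Union>c\<in>classes P. {i \<in> members P c. \<alpha> c i = l})" for l
  have F_members: "F l \<inter> members P c = {i \<in> members P c. \<alpha> c i = l}" if "c \<in> classes P" for c l
    using that members_unique unfolding F_def by blast
  have finL: "finite L" unfolding L_def using finite_classes finite_members by blast
  have "F l \<subseteq> items P" for l unfolding F_def items_Union by blast
  moreover have "F l \<noteq> {}" if "l \<in> L" for l using that unfolding F_def L_def by blast
  moreover have "items P = \<Union> (F ` L)" unfolding F_def L_def items_Union by blast
  moreover have "F l \<inter> F l' = {}" if "l \<noteq> l'" for l l'
    using that members_unique unfolding F_def by blast
  ultimately have "partition_on (items P) (F ` L)"
    unfolding partition_on_def disjoint_def by (intro conjI ballI impI) (blast | metis imageE)+
  moreover have "packing_pattern P (F l)" for l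
  proof (rule packing_patternI)
    show "F l \<subseteq> items P" by fact
    show "classes_of P (F l) \<subseteq> {c \<in> classes P. l \<in> \<alpha> c ` members P c}"
      unfolding classes_of_def F_def using members_unique by blast
    show "(\<Sum>c | c \<in> classes P \<and> l \<in> \<alpha> c ` members P c.
        sum (weight P) (F l \<inter> members P c) + setup_weight P c) \<le> capacity P"
      using load[of l] by (simp add: F_members)
  qed auto
  ultimately have "feasible_solution P (F ` L)" unfolding feasible_solution_def by blast
  then have "opt P \<le> solution_cost P (F ` L)" by (rule opt_le)
  also have "\<dots> = bin_cost P * card (F ` L) +
      (\<Sum>c\<in>classes P. setup_cost P c * card {S \<in> F ` L. S \<inter> members P c \<noteq> {}})"
    using finL by (simp add: solution_cost_by_class)
  also have "\<dots> \<le> bin_cost P * card L +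
    (\<Sum>c\<in>classes P. setup_cost P c * card (\<alpha> c ` members P c))"
  proof (intro add_mono sum_mono mult_left_mono)
    show "card (F ` L) \<le> card L" using finL by (rule card_image_le)
    fix c assume c: "c \<in> classes P"
    have "{S \<in> F ` L. S \<inter> members P c \<noteq> {}} \<subseteq> F ` \<alpha> c ` members P c"
    proof
      fix S assume "S \<in> {S \<in> F ` L. S \<inter> members P c \<noteq> {}}"
      then obtain l where "S = F l" "F l \<inter> members P c \<noteq> {}" by blast
      then show "S \<in> F ` \<alpha> c ` members P c" unfolding F_members[OF c] by blast
    qed
    then show "card {S \<in> F ` L. S \<inter> members P c \<noteq> {}} \<le> card (\<alpha> c ` members P c)"
      using finite_members[OF c] by (meson card_image_le card_mono finite_imageI le_trans)
  qed auto
  finally show ?thesis unfolding L_def .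
qed

text \<open>Singletons are packing patterns, so the minimum ranges over a nonempty finite set. It is
  positive because a partition of a nonempty set has a block and a bin has positive cost.\<close>

lemma opt_pos: "0 < opt P" and opt_attained: "\<exists>\<S>. optimal_solution P \<S>"
proof -
  have "packing_pattern P {i}" if i: "i \<in> items P" for i
  proof -
    obtain c where c: "c \<in> classes P" "i \<in> members P c" using i items_Union by blast
    have "weight P i + setup_weight P c \<le> capacity P"
      using inst c unfolding bpps_instance_def by blast
    then show ?thesis
      using i c members_unique by (intro packing_patternI[of _ "{c}"]) (auto simp: classes_of_def)
  qed
  then have "feasible_solution P ((\<lambda>i. {i}) ` items P)"
    unfolding feasible_solution_def partition_on_def disjoint_def by auto
  then have "opt P \<in> solution_cost P ` {\<S>. feasible_solution P \<S>}"
    unfolding opt_def using finite_solutions by (intro Min_in) auto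
  then obtain \<S> where S: "feasible_solution P \<S>" "opt P = solution_cost P \<S>" by auto
  then show "\<exists>\<S>. optimal_solution P \<S>" unfolding optimal_solution_def by auto
  have part: "partition_on (items P) \<S>" using S(1) unfolding feasible_solution_def by simp
  have "finite \<S>" using finite_elements[OF finite_items part] .
  moreover have "\<S> \<noteq> {}" using part items_nonempty unfolding partition_on_def by auto
  ultimately have "0 < bin_cost P * card \<S>" using bin_cost_pos by (simp add: card_gt_0_iff)
  then show "0 < opt P" unfolding S(2) solution_cost_def by simp
qed

section \<open>A lower bound for the linear program\<close>

definition class_load :: "nat \<Rightarrow> real" where
  "class_load c = real (sum (weight P) (members P c)) +
     of_int (min_class_bins P c) * real (setup_weight P c)"

text \<open>This quantity mediates between the two optima: it depends neither on \<open>k\<close>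
  nor on a fractional solution, and it is compared with each optimum separately.\<close>

definition cost_bound :: real where
  "cost_bound = real (bin_cost P) * (\<Sum>c\<in>classes P. class_load c) / real (capacity P) +
     (\<Sum>c\<in>classes P. real (setup_cost P c) * of_int (min_class_bins P c))"

text \<open>In the sum of the capacity constraints, the assignment equations turn the item part into
  the total weight. The minimum classes inequalities bound the setup part, and once more the setup
  costs.\<close>

lemma cost_bound_le_lp_objective:
  assumes "lp_feasible P k x y z"
  shows "cost_bound \<le> lp_objective P k y z"
proof -
  let ?B = "{1..k}"
  have x1: "(\<Sum>b\<in>?B. x i b) = 1" if "i \<in> items P" for i
    using assms that unfolding lp_feasible_def by blast
  have knap: "(\<Sum>i\<in>items P. real (weight P i) * x i b) +
      (\<Sum>c\<in>classes P. real (setup_weight P c) * y c b) \<le> real (capacity P) * z b" if "b \<in> ?B" for b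
    using assms that unfolding lp_feasible_def by blast
  have y1: "of_int (min_class_bins P c) \<le> (\<Sum>b\<in>?B. y c b)" if "c \<in> classes P" for c
    using assms that unfolding lp_feasible_def by blast
  have "(\<Sum>c\<in>classes P. real (sum (weight P) (members P c))) = real (sum (weight P) (items P))"
    unfolding sum_by_class[OF subset_refl] of_nat_sum using members_subset
    by (intro sum.cong refl) (auto simp: Int_absorb1)
  also have "\<dots> = (\<Sum>i\<in>items P. real (weight P i) * (\<Sum>b\<in>?B. x i b))"
    using x1 by simp
  also have "\<dots> = (\<Sum>b\<in>?B. \<Sum>i\<in>items P. real (weight P i) * x i b)"
    unfolding sum_distrib_left by (rule sum.swap)
  finally have W: "(\<Sum>c\<in>classes P. real (sum (weight P) (members P c))) = \<dots>" .
  have "(\<Sum>c\<in>classes P. of_int (min_class_bins P c) * real (setup_weight P c)) \<le>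
      (\<Sum>c\<in>classes P. real (setup_weight P c) * (\<Sum>b\<in>?B. y c b))"
    using y1 unfolding mult.commute[of _ "real (setup_weight P _)"]
    by (intro sum_mono mult_left_mono) auto
  also have "\<dots> = (\<Sum>b\<in>?B. \<Sum>c\<in>classes P. real (setup_weight P c) * y c b)"
    unfolding sum_distrib_left by (rule sum.swap)
  finally have "(\<Sum>c\<in>classes P. class_load c) \<le>
      (\<Sum>b\<in>?B. (\<Sum>i\<in>items P. real (weight P i) * x i b) +
      (\<Sum>c\<in>classes P. real (setup_weight P c) * y c b))"
    unfolding class_load_def sum.distrib W by linarith
  also have "\<dots> \<le> real (capacity P) * (\<Sum>b\<in>?B. z b)"
    unfolding sum_distrib_left by (intro sum_mono knap)
  finally have "(\<Sum>c\<in>classes P. class_load c) / real (capacity P) \<le> (\<Sum>b\<in>?B. z b)"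
    using capacity_pos by (simp add: field_simps)
  then have "real (bin_cost P) * (\<Sum>c\<in>classes P. class_load c) / real (capacity P) \<le>
      real (bin_cost P) * (\<Sum>b\<in>?B. z b)"
    by (metis mult_left_mono of_nat_0_le_iff times_divide_eq_right)
  moreover have "(\<Sum>c\<in>classes P. real (setup_cost P c) * of_int (min_class_bins P c)) \<le>
      (\<Sum>c\<in>classes P. real (setup_cost P c) * (\<Sum>b\<in>?B. y c b))"
    using y1 by (intro sum_mono mult_left_mono) auto
  moreover have "(\<Sum>c\<in>classes P. real (setup_cost P c) * (\<Sum>b\<in>?B. y c b)) =
      (\<Sum>b\<in>?B. \<Sum>c\<in>classes P. real (setup_cost P c) * y c b)"
    unfolding sum_distrib_left by (rule sum.swap)
  ultimately show ?thesis
    unfolding cost_bound_def lp_objective_def sum.distrib sum_distrib_left[symmetric] by linarith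
qed

section \<open>Feasibility of the linear program\<close>

text \<open>The incidence vectors of a packing satisfy all constraints. This is what makes the set
  under the infimum in \<open>lp_value\<close> nonempty.\<close>

lemma lp_feasible_of_solution:
  assumes feas: "feasible_solution P \<S>" and "card \<S> \<le> k"
  shows "\<exists>x y z. lp_feasible P k x y z"
proof -
  have part: "partition_on (items P) \<S>" using feas unfolding feasible_solution_def by simp
  have fin: "finite \<S>" using finite_elements[OF finite_items part] .
  have U: "\<Union>\<S> = items P" "{} \<notin> \<S>" and disj: "disjoint \<S>"
    using part unfolding partition_on_def by auto
  obtain h where h: "bij_betw h {1..card \<S>} \<S>"
    using ex_bij_betw_nat_finite_1[OF fin] by blast
  \<comment> \<open>The blocks are numbered from 1, and empty bins fill the list up to
    \<open>k\<close>.\<close>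
  define g where "g b = (if b \<le> card \<S> then h b else {})" for b
  have g_in: "g b = {} \<or> g b \<in> \<S>" if "b \<in> {1..k}" for b
    using h that unfolding g_def bij_betw_def by auto
  have pat: "packing_pattern P (g b)" if "b \<in> {1..k}" for b
    using g_in[OF that] feas unfolding feasible_solution_def
    by (auto simp: packing_pattern_def classes_of_def)
  have one: "\<exists>b\<in>{1..k}. \<forall>b'\<in>{1..k}. i \<in> g b' \<longleftrightarrow> b' = b" if i: "i \<in> items P" for i
  proof -
    obtain S where S: "S \<in> \<S>" "i \<in> S" using i U by blast
    then obtain b where b: "b \<in> {1..card \<S>}" "h b = S"
      using h unfolding bij_betw_def by (metis imageE)
    have "b' = b" if "b' \<in> {1..k}" "i \<in> g b'" for b'
    proof -
      have b': "b' \<in> {1..card \<S>}" "i \<in> h b'"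
        using that by (auto simp: g_def split: if_splits)
      then have "h b' \<in> \<S>" using h unfolding bij_betw_def by auto
      then have "h b' = h b" using b'(2) S b(2) disj unfolding disjoint_def by blast
      then show ?thesis using h b(1) b'(1) unfolding bij_betw_def inj_on_def by blast
    qed
    moreover have "i \<in> g b" "b \<in> {1..k}" using b S assms(2) by (auto simp: g_def)
    ultimately show ?thesis by blast
  qed
  define x where "x i b = (if i \<in> g b then 1 else 0 :: real)" for i b
  define y where "y c b = (if c \<in> classes_of P (g b) then 1 else 0 :: real)" for c b
  define z where "z b = (if g b \<noteq> {} then 1 else 0 :: real)" for b
  have x_sum: "(\<Sum>b\<in>{1..k}. x i b) = 1" if i: "i \<in> items P" for i
  proof -
    obtain b where b: "b \<in> {1..k}" "\<forall>b'\<in>{1..k}. i \<in> g b' \<longleftrightarrow> b' = b" using one[OF i] by blast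
    have "(\<Sum>b\<in>{1..k}. x i b) = (\<Sum>b'\<in>{1..k}. if b' = b then 1 else 0)"
      using b(2) unfolding x_def by (intro sum.cong) auto
    then show ?thesis using b(1) by simp
  qed
  have knap: "(\<Sum>i\<in>items P. real (weight P i) * x i b) +
      (\<Sum>c\<in>classes P. real (setup_weight P c) * y c b) \<le> real (capacity P) * z b"
    if b: "b \<in> {1..k}" for b
  proof -
    have sub: "g b \<subseteq> items P" and fit: "sum (weight P) (g b) +
        sum (setup_weight P) (classes_of P (g b)) \<le> capacity P"
      using pat[OF b] unfolding packing_pattern_def by auto
    have 1: "(\<Sum>i\<in>items P. real (weight P i) * x i b) = real (sum (weight P) (g b))"
      unfolding of_nat_sum using finite_items sub
      by (intro sum.mono_neutral_cong_right) (auto simp: x_def)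
    have 2: "(\<Sum>c\<in>classes P. real (setup_weight P c) * y c b) =
        real (sum (setup_weight P) (classes_of P (g b)))"
      unfolding of_nat_sum using finite_classes
      by (intro sum.mono_neutral_cong_right) (auto simp: y_def classes_of_def)
    show ?thesis
    proof (cases "g b = {}")
      case True
      then show ?thesis unfolding 1 2 by (simp add: z_def classes_of_def)
    next
      case False
      then show ?thesis unfolding 1 2 using fit
        by (simp add: z_def flip: of_nat_add of_nat_sum)
    qed
  qed
  have y_sum: "of_int (min_class_bins P c) \<le> (\<Sum>b\<in>{1..k}. y c b)" if c: "c \<in> classes P" for c
  proof -
    let ?D = "real (capacity P) - real (setup_weight P c)"
    have D: "?D > 0" using setup_less_capacity[OF c] by simp
    \<comment> \<open>A bin containing the class has at most \<open>?D\<close> left for its items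
      after the setup; in any other bin both sides vanish.\<close>
    have row: "(\<Sum>i\<in>members P c. real (weight P i) * x i b) \<le> ?D * y c b"
      if b: "b \<in> {1..k}" for b
    proof (cases "c \<in> classes_of P (g b)")
      case True
      have "(\<Sum>i\<in>members P c. real (weight P i) * x i b) \<le>
          (\<Sum>i\<in>items P. real (weight P i) * x i b)"
        using finite_items members_subset[OF c] by (intro sum_mono2) (auto simp: x_def)
      moreover have "real (setup_weight P c) * y c b \<le> (\<Sum>c\<in>classes P. real (setup_weight P c) * y c b)"
        using finite_classes c by (intro member_le_sum) (auto simp: y_def)
      moreover have "real (capacity P) * z b \<le> real (capacity P)" by (simp add: z_def)
      ultimately show ?thesis using knap[OF b] True by (simp add: y_def)
    next
      case False
      then have "(\<Sum>i\<in>members P c. real (weight P i) * x i b) = 0"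
        using c by (intro sum.neutral) (auto simp: x_def classes_of_def)
      then show ?thesis using False by (simp add: y_def)
    qed
    have "(\<Sum>i\<in>members P c. real (weight P i)) =
        (\<Sum>i\<in>members P c. real (weight P i) * (\<Sum>b\<in>{1..k}. x i b))"
      using x_sum members_subset[OF c] by (intro sum.cong) auto
    also have "\<dots> = (\<Sum>b\<in>{1..k}. \<Sum>i\<in>members P c. real (weight P i) * x i b)"
      unfolding sum_distrib_left by (rule sum.swap)
    also have "\<dots> \<le> ?D * (\<Sum>b\<in>{1..k}. y c b)"
      unfolding sum_distrib_left by (intro sum_mono row)
    finally have le: "(\<Sum>i\<in>members P c. real (weight P i)) / ?D \<le> (\<Sum>b\<in>{1..k}. y c b)"
      using D by (simp add: field_simps)
    \<comment> \<open>The sum of the \<open>y c b\<close> is an integer, so its lower bound may be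
      rounded up to the ceiling.\<close>
    define N where "N = card {b \<in> {1..k}. c \<in> classes_of P (g b)}"
    have N: "(\<Sum>b\<in>{1..k}. y c b) = real_of_int (int N)"
      unfolding y_def N_def by (simp add: sum.inter_filter[symmetric])
    show ?thesis using le unfolding min_class_bins_def N of_int_le_iff by (rule ceiling_le)
  qed
  have "x i b \<le> y c b" if "c \<in> classes P" "i \<in> members P c" for c i b
    using that by (auto simp: x_def y_def classes_of_def)
  then have "lp_feasible P k x y z"
    unfolding lp_feasible_def using x_sum knap y_sum by (auto simp: x_def y_def z_def)
  then show ?thesis by blast
qed

section \<open>Bin counts against class loads\<close>

lemma class_load_ge_single:
  assumes "c \<in> classes P"
  shows "real (sum (weight P) (members P c) + setup_weight P c) \<le> class_load c"
proof -
  have "1 * real (setup_weight P c) \<le> of_int (min_class_bins P c) * real (setup_weight P c)"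
    using min_class_bins_pos[OF assms] by (intro mult_right_mono) auto
  then show ?thesis unfolding class_load_def by simp
qed

text \<open>Combining the hypothesis with \<open>class_weight_le\<close> and cancelling
  \<open>d - s\<^sub>c\<close> gives \<open>n < 2 \<gamma>\<^sub>c\<close>. Integrality yields the
  extra 1, which later leaves room for one additional bin.\<close>

lemma min_class_bins_gt_half:
  assumes c: "c \<in> classes P"
    and "n * (capacity P - setup_weight P c) < 2 * sum (weight P) (members P c)"
  shows "int n + 1 \<le> 2 * min_class_bins P c"
proof -
  let ?D = "real (capacity P) - real (setup_weight P c)"
  have D: "?D > 0" using setup_less_capacity[OF c] by simp
  have eq: "real (capacity P - setup_weight P c) = ?D" using setup_less_capacity[OF c] by simp
  have "real n * ?D < 2 * real (sum (weight P) (members P c))"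
    using assms(2) unfolding eq[symmetric] by (metis of_nat_less_iff of_nat_mult of_nat_numeral)
  also have "\<dots> \<le> (2 * of_int (min_class_bins P c)) * ?D" using class_weight_le[OF c] by simp
  finally have "real n < 2 * of_int (min_class_bins P c)" using D by (simp add: mult_less_cancel_right)
  then show ?thesis by linarith
qed

text \<open>\<open>V\<close> is the load of an additional bin outside the class; it is \<open>0\<close> if there is none.\<close>

lemma class_load_gt:
  assumes c: "c \<in> classes P" and n: "int n \<le> 2 * min_class_bins P c"
    and "n * (capacity P - setup_weight P c) < 2 * (sum (weight P) (members P c) + V)"
  shows "real n * real (capacity P) < 2 * (class_load c + real V)"
proof -
  have eq: "real (capacity P - setup_weight P c) = real (capacity P) - real (setup_weight P c)"
    using setup_less_capacity[OF c] by simp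
  have "real (n * (capacity P - setup_weight P c)) < real (2 * (sum (weight P) (members P c) + V))"
    using assms(3) by (simp only: of_nat_less_iff)
  then have "real n * (real (capacity P) - real (setup_weight P c)) <
      2 * (real (sum (weight P) (members P c)) + real V)"
    unfolding of_nat_mult eq by simp
  moreover have "real n * real (setup_weight P c) \<le>
      (2 * of_int (min_class_bins P c)) * real (setup_weight P c)"
    using n by (intro mult_right_mono) linarith+
  ultimately show ?thesis unfolding class_load_def by (simp add: algebra_simps)
qed

section \<open>An upper bound for the optimum\<close>

lemma opt_less_cost_bound: "real (opt P) < 2 * cost_bound"
proof -
  let ?d = "capacity P" and ?s = "setup_weight P" and ?W = "\<lambda>c. sum (weight P) (members P c)"
  have "\<exists>a :: nat \<Rightarrow> nat. unmergeable_packing (members P c) (weight P) (?d - ?s c) a"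
    if c: "c \<in> classes P" for c
  proof (rule ex_unmergeable_packing[OF finite_members[OF c]])
    show "weight P i \<le> ?d - ?s c" if "i \<in> members P c" for i
      using inst c that unfolding bpps_instance_def by fastforce
  qed
  then obtain a :: "nat \<Rightarrow> nat \<Rightarrow> nat" where packing_a:
    "\<And>c. c \<in> classes P \<Longrightarrow> unmergeable_packing (members P c) (weight P) (?d - ?s c) (a c)"
    by metis
  define u where "u c j = sum (weight P) {i \<in> members P c. a c i = j}" for c j :: nat
  define J where "J c = a c ` members P c" for c
  define big where "big = {c \<in> classes P. 2 \<le> card (J c)}"
  define small where "small = classes P - big"
  define v where "v c = ?W c + ?s c" for c
  have classes: "classes P = big \<union> small" "big \<inter> small = {}" and bigD: "big \<subseteq> classes P"
    and smallD: "small \<subseteq> classes P"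
    by (auto simp: big_def small_def)
  have fin: "finite big" "finite small" using finite_classes by (simp_all add: big_def small_def)
  have finJ: "finite (J c)" if "c \<in> classes P" for c
    using finite_members[OF that] by (simp add: J_def)
  have sum_u: "sum (u c) (J c) = ?W c" if "c \<in> classes P" for c
    unfolding u_def J_def by (rule sum_over_fibers[OF finite_members[OF that]])
  have u_le: "u c j + ?s c \<le> ?d" if "c \<in> classes P" for c j
  proof -
    have "u c j \<le> ?d - ?s c"
      using packing_a[OF that] unfolding u_def unmergeable_packing_def by blast
    then show ?thesis using setup_less_capacity[OF that] by simp
  qed
  have u_gt: "?d - ?s c < u c j + u c j'"
    if "c \<in> classes P" "j \<in> J c" "j' \<in> J c" "j \<noteq> j'" for c j j'
    using packing_a[OF that(1)] that(2-4) unfolding u_def J_def unmergeable_packing_def by blast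
  \<comment> \<open>The packing of a small class uses exactly one bin, so the whole class and its
    setup fit into one bin of full capacity.\<close>
  have v_le: "v c \<le> ?d" if c: "c \<in> small" for c
  proof -
    have cl: "c \<in> classes P" using c smallD by blast
    have "J c \<noteq> {}" using inst cl unfolding bpps_instance_def J_def by auto
    then have "0 < card (J c)" using finJ[OF cl] by (simp add: card_gt_0_iff)
    moreover have "card (J c) < 2" using c cl by (auto simp: small_def big_def)
    ultimately have "card (J c) = 1" by linarith
    then obtain j where "J c = {j}" by (auto simp: card_1_singleton_iff)
    then show ?thesis using sum_u[OF cl] u_le[OF cl, of j] by (simp add: v_def)
  qed
  obtain e :: "nat \<Rightarrow> nat" where packing_e: "unmergeable_packing small v ?d e"
    using ex_unmergeable_packing[OF fin(2), of v, OF v_le] by blast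
  have e: "sum v {c \<in> small. e c = j} \<le> ?d" for j
    using packing_e unfolding unmergeable_packing_def by blast
  have e_gt: "?d < sum v {c \<in> small. e c = j} + sum v {c \<in> small. e c = j'}"
    if "j \<in> e ` small" "j' \<in> e ` small" "j \<noteq> j'" for j j'
    using packing_e that unfolding unmergeable_packing_def by blast
  \<comment> \<open>Pairing with the class keeps the bins of different big classes apart.\<close>
  define T where "T = (\<Union>c\<in>big. Pair c ` J c)"
  have finT: "finite T" unfolding T_def using fin finJ bigD by auto
  have card_T: "card T \<le> (\<Sum>c\<in>big. card (J c))"
    unfolding T_def using fin(1) by (rule card_UN_le[THEN le_trans]) (simp add: card_image inj_on_def)
  have big_gamma: "int (card (J c)) + 1 \<le> 2 * min_class_bins P c"
    and big_load: "real (card (J c)) * real ?d < 2 * class_load c" if c: "c \<in> big" for c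
  proof -
    have cl: "c \<in> classes P" using c bigD by blast
    have less: "card (J c) * (?d - ?s c) < 2 * ?W c"
      unfolding sum_u[OF cl, symmetric]
      using c finJ[OF cl] u_gt[OF cl] by (intro pairwise_sum_bound) (auto simp: big_def)
    show gam: "int (card (J c)) + 1 \<le> 2 * min_class_bins P c"
      by (rule min_class_bins_gt_half[OF cl less])
    show "real (card (J c)) * real ?d < 2 * class_load c"
      using class_load_gt[OF cl, of "card (J c)" 0] gam less by simp
  qed
  \<comment> \<open>Big classes keep their own bins; a small class goes as a whole into bin
    \<open>e c\<close>, whose final label is chosen by \<open>g\<close>. The case distinction below
    only varies \<open>g\<close>: \<open>Pair 0\<close> opens new bins, a constant map reuses a bin
    of a big class.\<close>
  define \<alpha> where "\<alpha> g c i = (if c \<in> big then (c, a c i) else g (e c) :: nat \<times> nat)" for g c i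
  \<comment> \<open>The setup costs are always within the factor 2: a big class meets
    \<open>card (J c)\<close> bins and a small one a single bin. Only the number of bins remains to
    be bounded, and the strictness comes from there.\<close>
  have finish: ?thesis
    if load: "\<And>l. (\<Sum>c | c \<in> classes P \<and> l \<in> \<alpha> g c ` members P c.
        sum (weight P) {i \<in> members P c. \<alpha> g c i = l} + ?s c) \<le> ?d"
      and count: "card (T \<union> g ` e ` small) \<le> N"
        "real N * real ?d < 2 * (\<Sum>c\<in>classes P. class_load c)" for g N
  proof -
    have "(\<Union>c\<in>classes P. \<alpha> g c ` members P c) \<subseteq> T \<union> g ` e ` small"
    proof (intro UN_least image_subsetI)
      fix c i assume "c \<in> classes P" "i \<in> members P c"
      then show "\<alpha> g c i \<in> T \<union> g ` e ` small"
        unfolding \<alpha>_def T_def J_def small_def by (cases "c \<in> big") auto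
    qed
    then have "card (\<Union>c\<in>classes P. \<alpha> g c ` members P c) \<le> N"
      using count(1) finT fin(2) by (meson card_mono finite_UnI finite_imageI le_trans)
    moreover have "real (card (\<alpha> g c ` members P c)) \<le> 2 * of_int (min_class_bins P c)"
      if c: "c \<in> classes P" for c
    proof (cases "c \<in> big")
      case True
      then have "\<alpha> g c ` members P c = Pair c ` J c" by (auto simp: \<alpha>_def J_def)
      then have "card (\<alpha> g c ` members P c) = card (J c)" by (simp add: card_image inj_on_def)
      then show ?thesis using big_gamma[OF True] by linarith
    next
      case False
      then have "\<alpha> g c ` members P c \<subseteq> {g (e c)}" by (auto simp: \<alpha>_def)
      then have "card (\<alpha> g c ` members P c) \<le> card {g (e c)}" by (rule card_mono[rotated]) simp
      then have "card (\<alpha> g c ` members P c) \<le> 1" by simp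
      then show ?thesis using min_class_bins_pos[OF c] by linarith
    qed
    ultimately have "real (bin_cost P * card (\<Union>c\<in>classes P. \<alpha> g c ` members P c) +
        (\<Sum>c\<in>classes P. setup_cost P c * card (\<alpha> g c ` members P c))) \<le>
      real (bin_cost P) * real N +
        (\<Sum>c\<in>classes P. real (setup_cost P c) * (2 * of_int (min_class_bins P c)))"
      unfolding of_nat_add of_nat_mult of_nat_sum
      by (intro add_mono sum_mono mult_left_mono) auto
    then have "real (opt P) \<le> real (bin_cost P) * real N +
        (\<Sum>c\<in>classes P. real (setup_cost P c) * (2 * of_int (min_class_bins P c)))"
      using opt_le_assignment[OF load] by (meson of_nat_le_iff order_trans)
    also have "\<dots> < real (bin_cost P) * (2 * (\<Sum>c\<in>classes P. class_load c) / real ?d) +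
        (\<Sum>c\<in>classes P. real (setup_cost P c) * (2 * of_int (min_class_bins P c)))"
      using count(2) bin_cost_pos capacity_pos
      by (intro add_strict_right_mono mult_strict_left_mono) (auto simp: field_simps)
    also have "(\<Sum>c\<in>classes P. real (setup_cost P c) * (2 * of_int (min_class_bins P c))) =
        2 * (\<Sum>c\<in>classes P. real (setup_cost P c) * of_int (min_class_bins P c))"
      unfolding sum_distrib_left by (intro sum.cong) auto
    also have "real (bin_cost P) * (2 * (\<Sum>c\<in>classes P. class_load c) / real ?d) + \<dots> =
        2 * cost_bound"
      unfolding cost_bound_def by simp
    finally show ?thesis .
  qed
  \<comment> \<open>It suffices to bound the load over a superset \<open>Z\<close> of the classes in
    the bin, with \<open>h\<close> estimating the share of each class.\<close>
  have loadI: "(\<Sum>c | c \<in> classes P \<and> l \<in> \<alpha> g c ` members P c.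
        sum (weight P) {i \<in> members P c. \<alpha> g c i = l} + ?s c) \<le> ?d"
    if "{c \<in> classes P. l \<in> \<alpha> g c ` members P c} \<subseteq> Z" "finite Z" "sum h Z \<le> ?d"
      "\<And>c. c \<in> Z \<Longrightarrow> sum (weight P) {i \<in> members P c. \<alpha> g c i = l} + ?s c \<le> h c" for l g Z h
  proof -
    have "(\<Sum>c | c \<in> classes P \<and> l \<in> \<alpha> g c ` members P c.
        sum (weight P) {i \<in> members P c. \<alpha> g c i = l} + ?s c) \<le>
        (\<Sum>c\<in>Z. sum (weight P) {i \<in> members P c. \<alpha> g c i = l} + ?s c)"
      using that(1,2) by (intro sum_mono2) auto
    also have "\<dots> \<le> sum h Z" using that(4) by (rule sum_mono)
    finally show ?thesis using that(3) by linarith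
  qed
  have big_part: "sum (weight P) {i \<in> members P c. \<alpha> g c i = (c, j)} + ?s c \<le> u c j + ?s c"
    if "c \<in> big" for g c j
    using that unfolding \<alpha>_def u_def by simp
  have small_part: "sum (weight P) {i \<in> members P c. \<alpha> g c i = l} + ?s c \<le> v c"
    if "c \<in> small" for g c l
    unfolding v_def using that smallD finite_members by (intro add_right_mono sum_mono2) auto
  text \<open>Classes are numbered from 1, so the labels \<open>(0, t)\<close> are free for the bins of small classes.\<close>
  have load0: "(\<Sum>c | c \<in> classes P \<and> l \<in> \<alpha> (Pair 0) c ` members P c.
        sum (weight P) {i \<in> members P c. \<alpha> (Pair 0) c i = l} + ?s c) \<le> ?d" for l
  proof -
    obtain p j where l: "l = (p, j)" by (cases l)
    have pos: "c \<noteq> 0" if "c \<in> classes P" for c using that by (auto simp: classes_def)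
    show ?thesis
    proof (cases "p = 0")
      case True
      show ?thesis
      proof (rule loadI[where Z = "{c \<in> small. e c = j}" and h = v])
        show "{c \<in> classes P. l \<in> \<alpha> (Pair 0) c ` members P c} \<subseteq> {c \<in> small. e c = j}"
          using True pos by (auto simp: l \<alpha>_def small_def)
      qed (use fin e small_part in auto)
    next
      case False
      show ?thesis
      proof (rule loadI[where Z = "{p} \<inter> big" and h = "\<lambda>c. u c j + ?s c"])
        show "{c \<in> classes P. l \<in> \<alpha> (Pair 0) c ` members P c} \<subseteq> {p} \<inter> big"
          using False by (auto simp: l \<alpha>_def split: if_splits)
        show "(\<Sum>c\<in>{p} \<inter> big. u c j + ?s c) \<le> ?d"
          using u_le bigD by (cases "p \<in> big") auto
      qed (use big_part l in auto)
    qed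
  qed
  define V where "V = sum v small"
  let ?A = "\<Sum>c\<in>big. class_load c" and ?B = "\<Sum>c\<in>small. class_load c"
  have AB: "(\<Sum>c\<in>classes P. class_load c) = ?A + ?B"
    unfolding classes(1) using fin classes(2) by (rule sum.union_disjoint)
  have VB: "real V \<le> ?B"
    unfolding V_def of_nat_sum v_def using class_load_ge_single smallD by (intro sum_mono) auto
  let ?K = "\<Sum>c\<in>big. card (J c)"
  have A_strict: "real ?K * real ?d < 2 * ?A" if "big \<noteq> {}"
    unfolding of_nat_sum sum_distrib_left sum_distrib_right
    using fin(1) that big_load by (rule sum_strict_mono)
  \<comment> \<open>Without big classes both sides are 0, so strictness is lost here.\<close>
  then have A: "real ?K * real ?d \<le> 2 * ?A" by (cases "big = {}") auto
  have count0: "card (T \<union> Pair 0 ` e ` small) \<le> ?K + card (e ` small)"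
    using card_T by (rule card_Un_le[THEN le_trans, OF add_mono]) (simp add: fin card_image_le)
  have sum_e: "(\<Sum>j\<in>e ` small. sum v {c \<in> small. e c = j}) = V"
    unfolding V_def by (rule sum_over_fibers[OF fin(2)])
  consider "2 \<le> card (e ` small)" | "small = {}" | "card (e ` small) = 1"
  proof -
    assume "2 \<le> card (e ` small) \<Longrightarrow> thesis" "small = {} \<Longrightarrow> thesis" "card (e ` small) = 1 \<Longrightarrow> thesis"
    moreover have "card (e ` small) = 0 \<longleftrightarrow> small = {}" using fin(2) by simp
    ultimately show thesis by linarith
  qed
  then show ?thesis
  proof cases
    case 1
    have "card (e ` small) * ?d < 2 * V"
      unfolding sum_e[symmetric] using 1 fin(2) e_gt by (intro pairwise_sum_bound) auto
    then have "real (card (e ` small)) * real ?d < 2 * real V"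
      by (metis of_nat_less_iff of_nat_mult of_nat_numeral)
    then show ?thesis using A AB VB
      by (intro finish[OF load0 count0]) (simp add: algebra_simps)
  next
    case 2
    then have "big \<noteq> {}" using classes classes_nonempty by simp
    then show ?thesis using A_strict AB 2 by (intro finish[OF load0 count0]) simp
  next
    case 3
    show ?thesis
    proof (cases "big = {}")
      case True
      \<comment> \<open>With no big class, \<open>V\<close> is the total weight with all setups. The
        instance does not fit into one bin, which gives \<open>?d < V\<close>.\<close>
      have "sum (weight P) (items P) = (\<Sum>c\<in>classes P. ?W c)"
        unfolding sum_by_class[OF subset_refl] using members_subset
        by (intro sum.cong refl) (auto simp: Int_absorb1)
      then have "?d < V"
        using inst True classes(1) unfolding bpps_instance_def V_def v_def by (simp add: sum.distrib)
      then have "real ?d < 2 * real V" by simp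
      then show ?thesis using AB VB True 3
        by (intro finish[OF load0 count0]) simp
    next
      case False
      then obtain c0 where c0: "c0 \<in> big" by blast
      then have cl0: "c0 \<in> classes P" using bigD by blast
      show ?thesis
      proof (cases "\<exists>j\<in>J c0. u c0 j + ?s c0 + V \<le> ?d")
        case True
        then obtain j0 where j0: "j0 \<in> J c0" "u c0 j0 + ?s c0 + V \<le> ?d" by blast
        \<comment> \<open>All small classes join bin \<open>j0\<close> of \<open>c0\<close>. Its
          label already lies in \<open>T\<close>, so no bin is added.\<close>
        let ?g = "\<lambda>_ :: nat. (c0, j0)"
        have "(\<Sum>c | c \<in> classes P \<and> l \<in> \<alpha> ?g c ` members P c.
            sum (weight P) {i \<in> members P c. \<alpha> ?g c i = l} + ?s c) \<le> ?d" for l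
        proof (cases "l = (c0, j0)")
          case True
          have notin: "c0 \<notin> small" using c0 classes(2) by blast
          show ?thesis
          proof (rule loadI[where Z = "insert c0 small" and h = "\<lambda>c. if c = c0 then u c0 j0 + ?s c0 else v c"])
            show "{c \<in> classes P. l \<in> \<alpha> ?g c ` members P c} \<subseteq> insert c0 small"
              using True by (auto simp: \<alpha>_def small_def)
            have "(\<Sum>c\<in>small. if c = c0 then u c0 j0 + ?s c0 else v c) = V"
              unfolding V_def using notin by (intro sum.cong) auto
            then show "(\<Sum>c\<in>insert c0 small. if c = c0 then u c0 j0 + ?s c0 else v c) \<le> ?d"
              using fin(2) notin j0(2) by simp
          next
            fix c assume "c \<in> insert c0 small"
            then show "sum (weight P) {i \<in> members P c. \<alpha> ?g c i = l} + ?s c \<le>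
                (if c = c0 then u c0 j0 + ?s c0 else v c)"
              using big_part[OF c0, of ?g j0] small_part[of c ?g l] True by auto
          qed (use fin in auto)
        next
          case False
          obtain p j where l: "l = (p, j)" by (cases l)
          show ?thesis
          proof (rule loadI[where Z = "{p} \<inter> big" and h = "\<lambda>c. u c j + ?s c"])
            show "{c \<in> classes P. l \<in> \<alpha> ?g c ` members P c} \<subseteq> {p} \<inter> big"
              using False by (auto simp: l \<alpha>_def split: if_splits)
            show "(\<Sum>c\<in>{p} \<inter> big. u c j + ?s c) \<le> ?d"
              using u_le bigD by (cases "p \<in> big") auto
          qed (use big_part l in auto)
        qed
        moreover have "T \<union> ?g ` e ` small = T" using c0 j0(1) by (auto simp: T_def)
        then have "card (T \<union> ?g ` e ` small) \<le> ?K" using card_T by simp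
        moreover have "real ?K * real ?d < 2 * (\<Sum>c\<in>classes P. class_load c)"
          using A_strict[OF \<open>big \<noteq> {}\<close>] AB VB by linarith
        ultimately show ?thesis by (rule finish)
      next
        case no_fit: False
        \<comment> \<open>The bin of the small classes, of load \<open>V\<close>, is added as
          \<open>None\<close> to the bins of \<open>c0\<close>. It cannot join any of them, so the
          enlarged family is still pairwise unmergeable with respect to \<open>d - s\<^sub>c\<close>
          for \<open>c0\<close>.\<close>
        define u' where "u' = case_option V (u c0)"
        let ?J' = "insert None (Some ` J c0)"
        have card': "card ?J' = card (J c0) + 1" using finJ[OF cl0] by (simp add: card_image)
        have fits_not: "?d - ?s c0 < u c0 j + V" if "j \<in> J c0" for j
          using no_fit that setup_less_capacity[OF cl0] by fastforce
        have "card ?J' * (?d - ?s c0) < 2 * sum u' ?J'"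
        proof (rule pairwise_sum_bound)
          show "2 \<le> card ?J'" using c0 unfolding card' big_def by simp
          fix j j' assume "j \<in> ?J'" "j' \<in> ?J'" "j \<noteq> j'"
          then show "?d - ?s c0 < u' j + u' j'"
            using fits_not unfolding u'_def by (auto simp: add.commute[of V] intro: u_gt[OF cl0])
        qed (use finJ[OF cl0] in simp)
        moreover have "sum u' ?J' = ?W c0 + V"
          using finJ[OF cl0] sum_u[OF cl0] by (simp add: u'_def sum.reindex)
        \<comment> \<open>The spare unit in \<open>big_gamma\<close> admits
          \<open>card (J c0) + 1\<close> bins in \<open>class_load_gt\<close>.\<close>
        ultimately have "real (card (J c0) + 1) * real ?d < 2 * (class_load c0 + real V)"
          unfolding card' using big_gamma[OF c0] by (intro class_load_gt[OF cl0]) auto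
        moreover have "real (\<Sum>c\<in>big - {c0}. card (J c)) * real ?d \<le> 2 * (\<Sum>c\<in>big - {c0}. class_load c)"
          unfolding of_nat_sum sum_distrib_left sum_distrib_right
          using big_load by (intro sum_mono) (auto intro: less_imp_le)
        moreover have "?A = class_load c0 + (\<Sum>c\<in>big - {c0}. class_load c)"
          "?K = card (J c0) + (\<Sum>c\<in>big - {c0}. card (J c))"
          using fin(1) c0 by (simp_all add: sum.remove)
        ultimately have "real (?K + card (e ` small)) * real ?d < 2 * (?A + ?B)"
          using VB 3 by (simp add: algebra_simps)
        then show ?thesis unfolding AB[symmetric] by (rule finish[OF load0 count0])
      qed
    qed
  qed
qed

end

theorem proposition5:
  fixes P :: bpps and k :: nat
  assumes "bpps_instance P"
    and "k \<ge> 1"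
    and "\<And>\<S>. optimal_solution P \<S> \<Longrightarrow> card \<S> \<le> k"
  shows "lp_value P k / real (opt P) > 1 / 2"
proof -
  obtain \<S> where S: "optimal_solution P \<S>" using opt_attained[OF assms(1)] by blast
  \<comment> \<open>A lower bound of a set of reals passes to its infimum only if the set is
    nonempty; the bound \<open>k\<close> on optimal solutions ensures this.\<close>
  have "\<exists>x y z. lp_feasible P k x y z"
    using lp_feasible_of_solution[OF assms(1) _ assms(3)[OF S]] S
    unfolding optimal_solution_def by blast
  then have "cost_bound P \<le> lp_value P k"
    unfolding lp_value_def
    by (intro cInf_greatest) (auto intro: cost_bound_le_lp_objective[OF assms(1)])
  then have "real (opt P) < 2 * lp_value P k"
    using opt_less_cost_bound[OF assms(1)] by linarith
  then show ?thesis using opt_pos[OF assms(1)] by (simp add: field_simps)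
qed

end
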